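(* Let $(X,d)$ be an infinite compact ultrametric space. Then for all $\xi,\eta\in X$, $$\inf_{\tau} d_s^\tau(\xi,\eta)=d(\xi,\eta),$$ where $\tau$ runs over all choice functions.
   Context: Write the nonzero values of $d$ as a strictly decreasing sequence $\delta_0>\delta_1>\cdots$ tending to $0$. Michon tree: level $n$ vertices are the closed $\delta_n$-balls of $X$ (a clopen partition; the single level $0$ vertex, the root, is $X$); $[v]\subset X$ is the ball of the vertex $v$; there is a vertical edge from a level $n$ vertex $v$ to a level $n+1$ vertex $w$ iff $[w]\subset[v]$ (then $w$ is called a child of $v$). Points of $X$ correspond to infinite paths starting at the root. A choice function $\tau$ is given by choosing one child of every vertex; $\tau(v)\in X$ is the point whose path passes through $v$ and then follows the chosen children. Let $E$ be the set of ordered pairs $(v,w)$ of distinct vertices which are children of a common vertex $u$; if $u$ has level $n$ the pair has length $l(v,w)=\delta_n$ (the $d$-distance of any point of $[v]$ to any point of $[w]$). On $\ell^2(E)$ put $\pi_\tau(f)\psi(v,w)=f(\tau(v))\psi(v,w)$ for $f\in C(X)$ and $D\psi(v,w)=l(v,w)^{-1}\psi(w,v)$. The spectral distance is $d_s^\tau(x,y)=\sup\{|f(x)-f(y)|:f\in C(X),\ \|[D,\pi_\tau(f)]\|\le1\}\in[0,\infty]$, where $\|[D,\pi_\tau(f)]\|\le1$ means $|f(\tau(v))-f(\tau(w))|\le l(v,w)$ for all $(v,w)\in E$. *)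

theory Defs
  imports "HOL-Analysis.Analysis"
begin

definition ultrametric_on :: "'a::metric_space set \<Rightarrow> bool" where
  "ultrametric_on X \<longleftrightarrow>
     (\<forall>x\<in>X. \<forall>y\<in>X. \<forall>z\<in>X. dist x z \<le> max (dist x y) (dist y z))"

text \<open>The sequence is unique if it exists; it exists when \<open>X\<close> is an infinite compact
  ultrametric space.\<close>

definition delta :: "'a::metric_space set \<Rightarrow> nat \<Rightarrow> real" where
  "delta X = (THE \<delta>. (\<forall>m n. m < n \<longrightarrow> \<delta> n < \<delta> m) \<and> \<delta> \<longlonglongrightarrow> 0 \<and>
     range \<delta> = {dist x y |x y. x \<in> X \<and> y \<in> X \<and> dist x y \<noteq> 0})"

text \<open>A vertex is a pair (level, ball): one and the same ball may occur on several levels (for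
  instance the singleton of an isolated point), and these are different vertices.\<close>

type_synonym 'a vertex = "nat \<times> 'a set"

definition vertices :: "'a::metric_space set \<Rightarrow> 'a vertex set" where
  "vertices X = {(n, X \<inter> cball x (delta X n)) |n x. x \<in> X}"

definition children :: "'a::metric_space set \<Rightarrow> 'a vertex \<Rightarrow> 'a vertex set" where
  "children X v = {w \<in> vertices X. fst w = Suc (fst v) \<and> snd w \<subseteq> snd v}"

definition choice_functions :: "'a::metric_space set \<Rightarrow> ('a vertex \<Rightarrow> 'a vertex) set" where
  "choice_functions X = {\<tau>. \<forall>v\<in>vertices X. \<tau> v \<in> children X v}"

text \<open>The point \<open>\<tau>(v)\<close>: the path through \<open>v\<close> that follows the chosen children passes through
  the iterates of \<open>\<tau>\<close> at \<open>v\<close> from the level of \<open>v\<close> on.\<close>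

definition choice_point :: "('a vertex \<Rightarrow> 'a vertex) \<Rightarrow> 'a vertex \<Rightarrow> 'a" where
  "choice_point \<tau> v = (THE x. \<forall>k. x \<in> snd ((\<tau> ^^ k) v))"

definition horizontal_edges :: "'a::metric_space set \<Rightarrow> ('a vertex \<times> 'a vertex) set" where
  "horizontal_edges X =
     {(v, w). v \<noteq> w \<and> (\<exists>u\<in>vertices X. v \<in> children X u \<and> w \<in> children X u)}"

text \<open>If \<open>v\<close> and \<open>w\<close> are children of \<open>u\<close>, then \<open>fst v - 1\<close> is the level of \<open>u\<close>.\<close>

definition edge_length :: "'a::metric_space set \<Rightarrow> 'a vertex \<times> 'a vertex \<Rightarrow> real" where
  "edge_length X = (\<lambda>(v, w). delta X (fst v - 1))"

text \<open>Elements of \<open>\<ell>\<^sup>2(A)\<close> are total functions vanishing outside \<open>A\<close>. The norm is infinite on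
  functions that are not square-summable.\<close>

definition ell2_norm :: "'e set \<Rightarrow> ('e \<Rightarrow> complex) \<Rightarrow> ennreal" where
  "ell2_norm A \<psi> =
     (if (\<lambda>e. (cmod (\<psi> e))\<^sup>2) summable_on A
      then ennreal (sqrt (\<Sum>\<^sub>\<infinity>e\<in>A. (cmod (\<psi> e))\<^sup>2)) else \<infinity>)"

definition ell2 :: "'e set \<Rightarrow> ('e \<Rightarrow> complex) set" where
  "ell2 A = {\<psi>. (\<forall>e. e \<notin> A \<longrightarrow> \<psi> e = 0) \<and> ell2_norm A \<psi> < \<infinity>}"

definition operator_norm ::
    "'e set \<Rightarrow> ('e \<Rightarrow> complex) set \<Rightarrow> (('e \<Rightarrow> complex) \<Rightarrow> 'e \<Rightarrow> complex) \<Rightarrow> ennreal" where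
  "operator_norm A V T = (SUP \<psi>\<in>{\<psi> \<in> V. ell2_norm A \<psi> \<le> 1}. ell2_norm A (T \<psi>))"

definition commutator ::
    "(('e \<Rightarrow> complex) \<Rightarrow> 'e \<Rightarrow> complex) \<Rightarrow> (('e \<Rightarrow> complex) \<Rightarrow> 'e \<Rightarrow> complex) \<Rightarrow>
     ('e \<Rightarrow> complex) \<Rightarrow> 'e \<Rightarrow> complex" where
  "commutator S T \<psi> = (\<lambda>e. S (T \<psi>) e - T (S \<psi>) e)"

definition choice_rep ::
    "('a vertex \<Rightarrow> 'a vertex) \<Rightarrow> ('a \<Rightarrow> complex) \<Rightarrow>
     ('a vertex \<times> 'a vertex \<Rightarrow> complex) \<Rightarrow> 'a vertex \<times> 'a vertex \<Rightarrow> complex" where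
  "choice_rep \<tau> f \<psi> = (\<lambda>(v, w). f (choice_point \<tau> v) * \<psi> (v, w))"

definition dirac ::
    "'a::metric_space set \<Rightarrow>
     ('a vertex \<times> 'a vertex \<Rightarrow> complex) \<Rightarrow> 'a vertex \<times> 'a vertex \<Rightarrow> complex" where
  "dirac X \<psi> = (\<lambda>(v, w). complex_of_real (inverse (edge_length X (v, w))) * \<psi> (w, v))"

text \<open>\<open>D\<close> is unbounded. It is taken with its maximal domain, on which it is self-adjoint; for
  bounded \<open>f\<close> this domain is invariant under multiplication by \<open>f\<close>, so it is also the domain of
  the commutator.\<close>

definition dirac_domain :: "'a::metric_space set \<Rightarrow> ('a vertex \<times> 'a vertex \<Rightarrow> complex) set" where
  "dirac_domain X =
     {\<psi> \<in> ell2 (horizontal_edges X). dirac X \<psi> \<in> ell2 (horizontal_edges X)}"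

definition spectral_dist ::
    "'a::metric_space set \<Rightarrow> ('a vertex \<Rightarrow> 'a vertex) \<Rightarrow> 'a \<Rightarrow> 'a \<Rightarrow> ennreal" where
  "spectral_dist X \<tau> x y =
     (SUP f\<in>{f :: 'a \<Rightarrow> complex. continuous_on X f \<and>
              operator_norm (horizontal_edges X) (dirac_domain X)
                (commutator (dirac X) (choice_rep \<tau> f)) \<le> 1}.
        ennreal (cmod (f x - f y)))"

end

theory Submission imports Defs begin

text \<open>By testing \<open>[D, \<pi>\<^sub>\<tau>(f)]\<close> on unit vectors, its norm is at most \<open>1\<close> iff
  \<open>\<bar>f(\<tau>(v)) - f(\<tau>(w))\<bar> \<le> l(v,w)\<close> on all horizontal edges. For every \<open>\<tau>\<close> the \<open>1\<close>-Lipschitz function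
  \<open>d(\<xi>, -)\<close> satisfies this and shows that \<open>d\<^sub>s\<^sup>\<tau>(\<xi>,\<eta>) \<ge> d(\<xi>,\<eta>)\<close>. Conversely, let \<open>d(\<xi>,\<eta>) = \<delta>\<^sub>n\<close>. The
  level \<open>n + 1\<close> balls around \<open>\<xi>\<close> and \<open>\<eta>\<close> form an edge of length \<open>\<delta>\<^sub>n\<close>, and for a choice function
  that follows \<open>\<xi>\<close> and \<open>\<eta>\<close> where possible, the constraint on this edge is
  \<open>\<bar>f(\<xi>) - f(\<eta>)\<bar> \<le> d(\<xi>,\<eta>)\<close>.\<close>

section \<open>Norms on sequence spaces\<close>

lemma ell2_norm_mono:
  assumes "\<And>e. e \<in> A \<Longrightarrow> cmod (\<phi> e) \<le> cmod (\<psi> e)"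
  shows "ell2_norm A \<phi> \<le> ell2_norm A \<psi>"
proof (cases "(\<lambda>e. (cmod (\<psi> e))\<^sup>2) summable_on A")
  case True
  have le: "(cmod (\<phi> e))\<^sup>2 \<le> (cmod (\<psi> e))\<^sup>2" if "e \<in> A" for e
    using assms[OF that] by (simp add: power_mono)
  have "(\<lambda>e. (cmod (\<phi> e))\<^sup>2) summable_on A"
    by (rule summable_on_comparison_test[OF True]) (use le in auto)
  moreover from this have "(\<Sum>\<^sub>\<infinity>e\<in>A. (cmod (\<phi> e))\<^sup>2) \<le> (\<Sum>\<^sub>\<infinity>e\<in>A. (cmod (\<psi> e))\<^sup>2)"
    using True le by (intro infsum_mono) auto
  ultimately show ?thesis
    using True by (simp add: ell2_norm_def ennreal_leI)
qed (simp add: ell2_norm_def)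

lemma ell2_norm_reindex:
  assumes "bij_betw g A A"
  shows "ell2_norm A (\<lambda>e. \<psi> (g e)) = ell2_norm A \<psi>"
  using summable_on_reindex_bij_betw[OF assms, of "\<lambda>e. (cmod (\<psi> e))\<^sup>2"]
    infsum_reindex_bij_betw[OF assms, of "\<lambda>e. (cmod (\<psi> e))\<^sup>2"]
  by (simp add: ell2_norm_def)

lemma ell2_norm_single:
  assumes "a \<in> A"
  shows "ell2_norm A (\<lambda>e. if e = a then c else 0) = ennreal (cmod c)"
proof -
  have "((\<lambda>e. (cmod (if e = a then c else 0))\<^sup>2) has_sum (cmod c)\<^sup>2) A"
    by (rule has_sum_finite_neutralI[where B = "{a}"]) (use assms in auto)
  then show ?thesis
    by (auto simp: ell2_norm_def infsumI has_sum_imp_summable)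
qed

lemma single_in_ell2: "a \<in> A \<Longrightarrow> (\<lambda>e. if e = a then c else 0) \<in> ell2 A"
  by (auto simp: ell2_def ell2_norm_single)

lemma operator_norm_le_iff:
  "operator_norm A V T \<le> c \<longleftrightarrow> (\<forall>\<psi>\<in>V. ell2_norm A \<psi> \<le> 1 \<longrightarrow> ell2_norm A (T \<psi>) \<le> c)"
  by (auto simp: operator_norm_def SUP_le_iff)

section \<open>Distances in compact ultrametric spaces\<close>

text \<open>Gives the uniqueness behind the definite description \<open>delta\<close>. If
  \<open>f\<close> and \<open>g\<close> agree below \<open>n\<close>, then \<open>f n = g j\<close>
  forces \<open>j \<ge> n\<close>, because \<open>f\<close> does not repeat values; hence
  \<open>f n \<le> g n\<close>, and by symmetry equality.\<close>

lemma strict_antimono_enumeration_unique: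
  fixes f g :: "nat \<Rightarrow> 'b::linorder"
  assumes f: "\<And>m n. m < n \<Longrightarrow> f n < f m" and g: "\<And>m n. m < n \<Longrightarrow> g n < g m"
    and range: "range f = range g"
  shows "f = g"
proof
  \<comment> \<open>Stated for fresh \<open>f\<close> and \<open>g\<close>, so that it can be
    applied in both directions.\<close>
  have le: "f n \<le> g n"
    if f: "\<And>m n. m < n \<Longrightarrow> f n < f m" and g: "\<And>m n. m < n \<Longrightarrow> g n < g m"
      and range: "range f \<subseteq> range g" and eq: "\<And>i. i < n \<Longrightarrow> f i = g i"
    for f g :: "nat \<Rightarrow> 'b" and n
  proof -
    obtain j where j: "f n = g j"
      using range by blast
    have "\<not> j < n"
      using f[of j n] eq[of j] j by auto
    then show ?thesis
      using j g[of n j] by (cases "j = n") auto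
  qed
  show "f n = g n" for n
  proof (induction n rule: less_induct)
    case (less n)
    have "f n \<le> g n"
      using less range by (intro le[OF f g]) auto
    moreover have "g n \<le> f n"
      using less range by (intro le[OF g f]) auto
    ultimately show ?case by order
  qed
qed

locale infinite_compact_ultrametric =
  fixes X :: "'a::metric_space set"
  assumes infinite_X: "infinite X" and compact_X: "compact X"
    and ultrametric_X: "ultrametric_on X"
begin

lemma ultrametric: "x \<in> X \<Longrightarrow> y \<in> X \<Longrightarrow> z \<in> X \<Longrightarrow> dist x z \<le> max (dist x y) (dist y z)"
  using ultrametric_X by (auto simp: ultrametric_on_def)

definition "distances = {dist x y |x y. x \<in> X \<and> y \<in> X \<and> dist x y \<noteq> 0}"

lemma finite_net:
  assumes "0 < e"
  obtains F where "finite F" "F \<subseteq> X" "\<And>x. x \<in> X \<Longrightarrow> \<exists>a\<in>F. dist a x < e"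
proof -
  have "\<exists>F. finite F \<and> F \<subseteq> X \<and> X \<subseteq> (\<Union>x\<in>F. ball x e)"
    using compact_X assms
    by (simp add: compact_eq_seq_compact_metric seq_compact_imp_totally_bounded)
  then show ?thesis
    using that by (force simp: subset_iff)
qed

text \<open>In an ultrametric, moving both endpoints by less than \<open>e\<close> does not change a
  distance that is at least \<open>e\<close>. So all these distances already occur between points of
  a finite \<open>e\<close>-net.\<close>

lemma finite_distances_ge:
  assumes "0 < e"
  shows "finite {s \<in> distances. e \<le> s}"
proof -
  obtain F where F: "finite F" "F \<subseteq> X" "\<And>x. x \<in> X \<Longrightarrow> \<exists>a\<in>F. dist a x < e"
    using finite_net[OF assms] by blast
  have "s \<in> (\<lambda>(a, b). dist a b) ` (F \<times> F)" if s: "s \<in> distances" "e \<le> s" for s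
  proof -
    obtain x y where xy: "x \<in> X" "y \<in> X" "s = dist x y"
      using s(1) by (auto simp: distances_def)
    obtain a b where ab: "a \<in> F" "b \<in> F" "dist a x < e" "dist b y < e"
      using F(3) xy by meson
    then have X: "a \<in> X" "b \<in> X"
      using F(2) by auto
    \<comment> \<open>The first two inequalities give \<open>s \<le> dist a b\<close>, since the
      other terms are below \<open>e \<le> s\<close>; the last two give the reverse.\<close>
    have "dist x y \<le> max (dist x a) (dist a y)" "dist a y \<le> max (dist a b) (dist b y)"
      "dist a b \<le> max (dist a x) (dist x b)" "dist x b \<le> max (dist x y) (dist y b)"
      using X xy by (auto intro: ultrametric)
    then have "s = dist a b"
      using ab(3,4) s(2) xy(3) by (auto simp: dist_commute max_def split: if_splits)
    then show ?thesis
      using ab by auto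
  qed
  then have "{s \<in> distances. e \<le> s} \<subseteq> (\<lambda>(a, b). dist a b) ` (F \<times> F)"
    by blast
  then show ?thesis
    by (rule finite_subset) (use F(1) in simp)
qed

lemma distances_pos: "s \<in> distances \<Longrightarrow> 0 < s"
  by (auto simp: distances_def)

text \<open>Here the infinitude of \<open>X\<close> enters: without positive distances below
  \<open>e\<close>, each point would equal the net point near it, and the net is finite.\<close>

lemma ex_distance_less:
  assumes "0 < e"
  shows "\<exists>s\<in>distances. s < e"
proof (rule ccontr)
  assume none: "\<not> ?thesis"
  obtain F where F: "finite F" "F \<subseteq> X" "\<And>x. x \<in> X \<Longrightarrow> \<exists>a\<in>F. dist a x < e"
    using finite_net[OF assms] by blast
  have "x \<in> F" if x: "x \<in> X" for x
  proof -
    obtain a where a: "a \<in> F" "dist a x < e"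
      using F(3) x by blast
    then have "dist a x \<notin> distances"
      using none by blast
    then show ?thesis
      using a F(2) x by (auto simp: distances_def)
  qed
  then show False
    using F(1) infinite_X finite_subset[of X F] by blast
qed

text \<open>Only finitely many elements of \<open>T\<close> lie above a given \<open>r\<close> in
  \<open>T\<close>; their maximum is the maximum of \<open>T\<close>.\<close>

lemma ex_Max_distances:
  assumes "T \<subseteq> distances" "T \<noteq> {}"
  shows "\<exists>s\<in>T. \<forall>t\<in>T. t \<le> s"
proof -
  obtain r where r: "r \<in> T"
    using assms(2) by blast
  let ?U = "{s \<in> T. r \<le> s}"
  have fin: "finite ?U"
    by (rule finite_subset[OF _ finite_distances_ge[of r]]) (use assms(1) r distances_pos in auto)
  have ne: "?U \<noteq> {}"
    using r by blast
  have "Max ?U \<in> ?U"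
    using Max_in[OF fin ne] .
  moreover have "t \<le> Max ?U" if "t \<in> T" for t
  proof (cases "r \<le> t")
    case True
    then show ?thesis using that fin by (intro Max_ge) auto
  next
    case False
    then show ?thesis using \<open>Max ?U \<in> ?U\<close> by auto
  qed
  ultimately show ?thesis by blast
qed

text \<open>Greedy enumeration: start with the largest distance and pass each time to the largest
  one strictly below. As only finitely many distances exceed a given positive bound, the sequence
  tends to 0 and misses no distance.\<close>

lemma ex_delta:
  "\<exists>\<delta>::nat \<Rightarrow> real. (\<forall>m n. m < n \<longrightarrow> \<delta> n < \<delta> m) \<and> \<delta> \<longlonglongrightarrow> 0 \<and> range \<delta> = distances"
proof -
  \<comment> \<open>\<open>?P\<close> makes the initial term the maximum; \<open>?Q\<close> says
    that no distance lies strictly between consecutive terms.\<close>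
  let ?P = "\<lambda>n x. x \<in> distances \<and> (n = (0::nat) \<longrightarrow> (\<forall>s\<in>distances. s \<le> x))"
  let ?Q = "\<lambda>(n::nat) x y. y < x \<and> (\<forall>s\<in>distances. s < x \<longrightarrow> s \<le> y)"
  have "\<exists>\<delta>. \<forall>n. ?P n (\<delta> n) \<and> ?Q n (\<delta> n) (\<delta> (Suc n))"
  proof (rule dependent_nat_choice)
    show "\<exists>x. ?P 0 x"
      using ex_Max_distances[of distances] ex_distance_less[of 1] by auto
  next
    fix x n assume "?P n x"
    then have "{s \<in> distances. s < x} \<noteq> {}"
      using ex_distance_less[of x] distances_pos by auto
    then show "\<exists>y. ?P (Suc n) y \<and> ?Q n x y"
      using ex_Max_distances[of "{s \<in> distances. s < x}"] by auto
  qed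
  then obtain \<delta> where \<delta>: "\<And>n. \<delta> n \<in> distances" "\<And>s. s \<in> distances \<Longrightarrow> s \<le> \<delta> 0"
    "\<And>n. \<delta> (Suc n) < \<delta> n" "\<And>n s. s \<in> distances \<Longrightarrow> s < \<delta> n \<Longrightarrow> s \<le> \<delta> (Suc n)"
    by auto
  have mono: "\<delta> n < \<delta> m" if "m < n" for m n
    using lift_Suc_mono_less[of "\<lambda>n. - \<delta> n" m n] \<delta>(3) that by simp
  have small: "\<exists>n. \<delta> n < e" if e: "0 < e" for e
  proof (rule ccontr)
    assume "\<nexists>n. \<delta> n < e"
    then have "range \<delta> \<subseteq> {s \<in> distances. e \<le> s}"
      using \<delta>(1) by (auto simp: not_less)
    moreover have "inj \<delta>"
      by (metis injI less_irrefl linorder_neqE_nat mono)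
    ultimately show False
      using finite_distances_ge[OF e] finite_subset range_inj_infinite by blast
  qed
  have "\<delta> \<longlonglongrightarrow> 0"
  proof (rule LIMSEQ_I)
    fix e :: real assume "0 < e"
    then obtain N where N: "\<delta> N < e"
      using small by blast
    have "norm (\<delta> n - 0) < e" if "N \<le> n" for n
      using N mono[of N n] distances_pos[OF \<delta>(1)[of n]] that by (cases "N = n") auto
    then show "\<exists>N. \<forall>n\<ge>N. norm (\<delta> n - 0) < e" by blast
  qed
  moreover have "s \<in> range \<delta>" if s: "s \<in> distances" for s
  proof -
    \<comment> \<open>The first term below \<open>s\<close> is not the initial one, so it has a
      predecessor, which is at least \<open>s\<close>. Nothing lies strictly between the two, so
      \<open>s\<close> is that predecessor.\<close>
    define n where "n = (LEAST n. \<delta> n < s)"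
    have n: "\<delta> n < s"
      unfolding n_def using small[OF distances_pos[OF s]] by (rule LeastI_ex)
    then obtain m where m: "n = Suc m"
      using \<delta>(2)[OF s] by (cases n) auto
    then have "\<not> \<delta> m < s"
      using not_less_Least[of m "\<lambda>n. \<delta> n < s"] n_def by auto
    then have "s = \<delta> m"
      using \<delta>(4)[OF s, of m] n m by fastforce
    then show ?thesis by simp
  qed
  ultimately show ?thesis
    using \<delta>(1) mono by blast
qed

lemma
  shows delta_less: "\<And>m n. m < n \<Longrightarrow> delta X n < delta X m"
    and delta_tendsto: "delta X \<longlonglongrightarrow> 0"
    and range_delta: "range (delta X) = distances"
proof -
  obtain \<delta> where \<delta>: "\<forall>m n. m < n \<longrightarrow> \<delta> n < \<delta> m" "\<delta> \<longlonglongrightarrow> 0" "range \<delta> = distances"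
    using ex_delta by blast
  have "delta X = \<delta>"
    unfolding delta_def distances_def[symmetric]
  proof (rule the_equality)
    show "(\<forall>m n. m < n \<longrightarrow> \<delta> n < \<delta> m) \<and> \<delta> \<longlonglongrightarrow> 0 \<and> range \<delta> = distances"
      using \<delta> by blast
  next
    fix g assume "(\<forall>m n. m < n \<longrightarrow> g n < g m) \<and> g \<longlonglongrightarrow> 0 \<and> range g = distances"
    then show "g = \<delta>"
      using \<delta> by (intro strict_antimono_enumeration_unique) auto
  qed
  then show "\<And>m n. m < n \<Longrightarrow> delta X n < delta X m" "delta X \<longlonglongrightarrow> 0"
    "range (delta X) = distances"
    using \<delta> by auto
qed

lemma delta_pos: "0 < delta X n"
  using distances_pos range_delta by blast

lemma delta_le: "m \<le> n \<Longrightarrow> delta X n \<le> delta X m"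
  using delta_less by (metis le_less order_refl)

section \<open>The Michon tree\<close>

lemma vertex_ball: "x \<in> X \<Longrightarrow> (n, X \<inter> cball x (delta X n)) \<in> vertices X"
  by (auto simp: vertices_def)

lemma vertex_nonempty: "v \<in> vertices X \<Longrightarrow> snd v \<noteq> {}"
  using delta_pos by (force simp: vertices_def intro: less_imp_le)

lemma vertex_subset: "v \<in> vertices X \<Longrightarrow> snd v \<subseteq> X"
  by (auto simp: vertices_def)

lemma compact_vertex: "v \<in> vertices X \<Longrightarrow> compact (snd v)"
  using compact_X by (auto simp: vertices_def intro: compact_Int_closed)

text \<open>The ultrametric inequality through the centre bounds the diameter of a ball by its
  radius, without the usual factor 2.\<close>

lemma dist_le_of_mem_vertex:
  assumes "v \<in> vertices X" "x \<in> snd v" "y \<in> snd v"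
  shows "dist x y \<le> delta X (fst v)"
proof -
  obtain n c where c: "c \<in> X" "v = (n, X \<inter> cball c (delta X n))"
    using assms(1) by (auto simp: vertices_def)
  then show ?thesis
    using ultrametric[of x c y] assms by (auto simp: dist_commute)
qed

text \<open>Every point of an ultrametric ball serves as its centre. This lets
  \<open>ball_child\<close> build a child around any chosen member.\<close>

lemma vertex_eq_ball:
  assumes "v \<in> vertices X" "x \<in> snd v"
  shows "snd v = X \<inter> cball x (delta X (fst v))"
proof -
  obtain n c where c: "c \<in> X" "v = (n, X \<inter> cball c (delta X n))"
    using assms(1) by (auto simp: vertices_def)
  have "y \<in> snd v" if "y \<in> X" "dist x y \<le> delta X n" for y
    using ultrametric[of c x y] c assms(2) that by auto
  then show ?thesis
    using dist_le_of_mem_vertex[OF assms] vertex_subset[OF assms(1)] c by auto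
qed

lemma ball_child:
  assumes "v \<in> vertices X" "x \<in> snd v"
  shows "(Suc (fst v), X \<inter> cball x (delta X (Suc (fst v)))) \<in> children X v"
proof -
  have "x \<in> X"
    using assms vertex_subset by blast
  moreover have "X \<inter> cball x (delta X (Suc (fst v))) \<subseteq> snd v"
    unfolding vertex_eq_ball[OF assms] by (intro Int_mono subset_cball delta_le) auto
  ultimately show ?thesis
    by (simp add: children_def vertex_ball)
qed

text \<open>The three facts are proved together because the choice property of \<open>\<tau>\<close>
  is available at vertices only.\<close>

lemma choice_iterates:
  assumes "\<tau> \<in> choice_functions X" "v \<in> vertices X"
  shows "(\<tau> ^^ k) v \<in> vertices X \<and> fst ((\<tau> ^^ k) v) = fst v + k
    \<and> snd ((\<tau> ^^ Suc k) v) \<subseteq> snd ((\<tau> ^^ k) v)"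
proof (induction k)
  case 0
  then show ?case
    using assms by (auto simp: choice_functions_def children_def)
next
  case (Suc k)
  then have "\<tau> ((\<tau> ^^ k) v) \<in> children X ((\<tau> ^^ k) v)"
    using assms by (auto simp: choice_functions_def)
  then have *: "(\<tau> ^^ Suc k) v \<in> vertices X" "fst ((\<tau> ^^ Suc k) v) = fst v + Suc k"
    using Suc by (auto simp: children_def)
  then have "\<tau> ((\<tau> ^^ Suc k) v) \<in> children X ((\<tau> ^^ Suc k) v)"
    using assms(1) by (auto simp: choice_functions_def)
  then show ?case
    using * by (auto simp: children_def)
qed

text \<open>The diameters along the path are bounded by a tail of \<open>delta X\<close>, which
  tends to 0.\<close>

lemma choice_point_unique:
  assumes "\<tau> \<in> choice_functions X" "v \<in> vertices X"
    and x: "\<And>k. x \<in> snd ((\<tau> ^^ k) v)" and y: "\<And>k. y \<in> snd ((\<tau> ^^ k) v)"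
  shows "x = y"
proof -
  have "dist x y \<le> delta X (k + fst v)" for k
    using dist_le_of_mem_vertex[OF _ x y, of k] choice_iterates[OF assms(1,2), of k]
    by (simp add: add.commute)
  moreover have "(\<lambda>k. delta X (k + fst v)) \<longlonglongrightarrow> 0"
    using delta_tendsto by (rule LIMSEQ_ignore_initial_segment)
  ultimately have "dist x y \<le> 0"
    by (intro LIMSEQ_le_const) auto
  then show ?thesis by simp
qed

lemma choice_point_eqI:
  assumes "\<tau> \<in> choice_functions X" "v \<in> vertices X" "\<And>k. x \<in> snd ((\<tau> ^^ k) v)"
  shows "choice_point \<tau> v = x"
  unfolding choice_point_def
  using assms choice_point_unique[OF assms(1,2)] by (intro the_equality) auto

text \<open>Existence of the limit point comes from compactness: the balls along the path are
  nested, closed and nonempty, so they have a common point.\<close>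

lemma choice_point_in:
  assumes "\<tau> \<in> choice_functions X" "v \<in> vertices X"
  shows "choice_point \<tau> v \<in> snd v"
proof -
  let ?B = "\<lambda>k. snd ((\<tau> ^^ k) v)"
  note it = choice_iterates[OF assms]
  have dec: "decseq ?B"
    using it by (intro decseq_SucI) blast
  have "X \<inter> (\<Inter>k. ?B k) \<noteq> {}"
  proof (rule compact_imp_fip_image[OF compact_X])
    show "closed (?B k)" for k
      using it compact_vertex compact_imp_closed by blast
  next
    fix I :: "nat set" assume I: "finite I"
    \<comment> \<open>A point of the deepest ball lies in all the others; inserting 0 keeps
      \<open>Max\<close> meaningful when \<open>I\<close> is empty.\<close>
    obtain x where x: "x \<in> ?B (Max (insert 0 I))"
      using it vertex_nonempty by blast
    have "x \<in> ?B k" if "k \<in> I" for k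
      using decseqD[OF dec, of k "Max (insert 0 I)"] I x that by auto
    moreover have "x \<in> X"
      using x it vertex_subset by blast
    ultimately show "X \<inter> (\<Inter>k\<in>I. ?B k) \<noteq> {}" by blast
  qed
  then obtain x where x: "\<And>k. x \<in> ?B k"
    by blast
  then show ?thesis
    using choice_point_eqI[OF assms x] x[of 0] by simp
qed

lemma horizontal_edgesE:
  assumes "(v, w) \<in> horizontal_edges X"
  obtains u where "u \<in> vertices X" "v \<in> children X u" "w \<in> children X u"
    "edge_length X (v, w) = delta X (fst u)"
  using assms that by (auto simp: horizontal_edges_def edge_length_def children_def)

lemma horizontal_edges_swap: "(w, v) \<in> horizontal_edges X \<longleftrightarrow> (v, w) \<in> horizontal_edges X"
  by (auto simp: horizontal_edges_def)

lemma edge_length_pos: "0 < edge_length X e"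
  by (cases e) (simp add: edge_length_def delta_pos)

text \<open>Both points lie in the ball of the common parent, whose diameter is at most the edge
  length.\<close>

lemma dist_choice_points_le:
  assumes "\<tau> \<in> choice_functions X" "(v, w) \<in> horizontal_edges X"
  shows "dist (choice_point \<tau> v) (choice_point \<tau> w) \<le> edge_length X (v, w)"
proof -
  obtain u where u: "u \<in> vertices X" "v \<in> children X u" "w \<in> children X u"
    "edge_length X (v, w) = delta X (fst u)"
    using horizontal_edgesE[OF assms(2)] .
  then have "choice_point \<tau> v \<in> snd u" "choice_point \<tau> w \<in> snd u"
    using choice_point_in[OF assms(1), of v] choice_point_in[OF assms(1), of w]
    by (auto simp: children_def)
  then show ?thesis
    using dist_le_of_mem_vertex[OF u(1)] u(4) by simp
qed

section \<open>The spectral distance\<close>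

text \<open>The commutator is the edge swap followed by a diagonal multiplier, so its norm is
  controlled edge by edge.\<close>

lemma commutator_dirac_choice_rep:
  "commutator (dirac X) (choice_rep \<tau> f) \<psi> (v, w) =
     complex_of_real (inverse (edge_length X (v, w)))
       * (f (choice_point \<tau> w) - f (choice_point \<tau> v)) * \<psi> (w, v)"
  by (simp add: commutator_def dirac_def choice_rep_def algebra_simps)

lemma commutator_norm_le_1_iff:
  "operator_norm (horizontal_edges X) (dirac_domain X)
      (commutator (dirac X) (choice_rep \<tau> f)) \<le> 1 \<longleftrightarrow>
    (\<forall>(v, w)\<in>horizontal_edges X.
       cmod (f (choice_point \<tau> v) - f (choice_point \<tau> w)) \<le> edge_length X (v, w))"
    (is "?norm \<le> 1 \<longleftrightarrow> ?bound")
proof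
  assume le: "?norm \<le> 1"
  show ?bound
  proof safe
    fix v w assume vw: "(v, w) \<in> horizontal_edges X"
    \<comment> \<open>The unit vector sits at the reversed edge because \<open>dirac\<close> swaps;
      its images under \<open>dirac\<close> and the commutator are then supported at
      \<open>(v, w)\<close>, which also places it in the domain.\<close>
    let ?\<psi> = "\<lambda>e. if e = (w, v) then 1 else (0::complex)"
    let ?c = "complex_of_real (inverse (edge_length X (v, w)))"
    let ?df = "f (choice_point \<tau> w) - f (choice_point \<tau> v)"
    have wv: "(w, v) \<in> horizontal_edges X"
      using vw by (simp add: horizontal_edges_swap)
    have D: "dirac X ?\<psi> = (\<lambda>e. if e = (v, w) then ?c else 0)"
      by (auto simp: dirac_def fun_eq_iff)
    have C: "commutator (dirac X) (choice_rep \<tau> f) ?\<psi>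
        = (\<lambda>e. if e = (v, w) then ?c * ?df else 0)"
      by (auto simp: fun_eq_iff commutator_dirac_choice_rep)
    have "?\<psi> \<in> dirac_domain X"
      unfolding dirac_domain_def mem_Collect_eq D
      using single_in_ell2[OF wv] single_in_ell2[OF vw] by blast
    moreover have "ell2_norm (horizontal_edges X) ?\<psi> \<le> 1"
      by (simp add: ell2_norm_single[OF wv])
    ultimately have "ell2_norm (horizontal_edges X)
        (commutator (dirac X) (choice_rep \<tau> f) ?\<psi>) \<le> 1"
      using le unfolding operator_norm_le_iff by blast
    then have "cmod (?c * ?df) \<le> 1"
      unfolding C ell2_norm_single[OF vw] by simp
    then have "inverse (edge_length X (v, w)) * cmod ?df \<le> 1"
      unfolding norm_mult norm_of_real using edge_length_pos[of "(v, w)"] by simp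
    then show "cmod (f (choice_point \<tau> v) - f (choice_point \<tau> w)) \<le> edge_length X (v, w)"
      using edge_length_pos[of "(v, w)"]
      by (simp add: norm_minus_commute field_simps)
  qed
next
  assume bound: ?bound
  let ?E = "horizontal_edges X"
  show "?norm \<le> 1"
    unfolding operator_norm_le_iff
  proof (intro ballI impI)
    fix \<psi> assume \<psi>: "ell2_norm ?E \<psi> \<le> 1"
    \<comment> \<open>Under the bound the multiplier has modulus at most 1, so only the swap is
      left, which permutes the edges and preserves the norm.\<close>
    have "cmod (commutator (dirac X) (choice_rep \<tau> f) \<psi> e) \<le> cmod (\<psi> (prod.swap e))"
      if e: "e \<in> ?E" for e
    proof -
      obtain v w where vw: "e = (v, w)"
        by (cases e)
      have "cmod (f (choice_point \<tau> w) - f (choice_point \<tau> v)) / edge_length X e \<le> 1"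
        using bound e vw edge_length_pos[of e] by (auto simp: norm_minus_commute)
      then have "cmod (f (choice_point \<tau> w) - f (choice_point \<tau> v)) / edge_length X e
          * cmod (\<psi> (w, v)) \<le> 1 * cmod (\<psi> (w, v))"
        by (rule mult_right_mono) simp
      then show ?thesis
        using edge_length_pos[of e]
        by (simp add: vw commutator_dirac_choice_rep norm_mult norm_inverse divide_inverse
            mult.commute)
    qed
    then have "ell2_norm ?E (commutator (dirac X) (choice_rep \<tau> f) \<psi>)
        \<le> ell2_norm ?E (\<lambda>e. \<psi> (prod.swap e))"
      by (rule ell2_norm_mono)
    also have "bij_betw prod.swap ?E ?E"
      by (rule bij_betwI[where g = prod.swap]) (auto simp: horizontal_edges_swap)
    then have "ell2_norm ?E (\<lambda>e. \<psi> (prod.swap e)) = ell2_norm ?E \<psi>"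
      by (rule ell2_norm_reindex)
    finally show "ell2_norm ?E (commutator (dirac X) (choice_rep \<tau> f) \<psi>) \<le> 1"
      using \<psi> by order
  qed
qed

lemma dist_le_spectral_dist:
  assumes "\<tau> \<in> choice_functions X"
  shows "ennreal (dist x y) \<le> spectral_dist X \<tau> x y"
proof -
  let ?f = "\<lambda>z. complex_of_real (dist x z)"
  have lip: "cmod (?f a - ?f b) \<le> dist a b" for a b
    using abs_dist_diff_le[of a x b]
    by (simp add: dist_commute flip: of_real_diff)
  have "cmod (?f (choice_point \<tau> v) - ?f (choice_point \<tau> w)) \<le> edge_length X (v, w)"
    if "(v, w) \<in> horizontal_edges X" for v w
    using lip dist_choice_points_le[OF assms that] order_trans by blast
  then have "operator_norm (horizontal_edges X) (dirac_domain X)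
      (commutator (dirac X) (choice_rep \<tau> ?f)) \<le> 1"
    unfolding commutator_norm_le_1_iff by auto
  moreover have "continuous_on X ?f"
    by (intro continuous_intros)
  ultimately have "ennreal (cmod (?f x - ?f y)) \<le> spectral_dist X \<tau> x y"
    unfolding spectral_dist_def by (intro SUP_upper) auto
  then show ?thesis by simp
qed

text \<open>Where both points are available \<open>x\<close> takes priority; where neither is, any
  member serves as centre.\<close>

definition adapted_choice :: "'a \<Rightarrow> 'a \<Rightarrow> 'a vertex \<Rightarrow> 'a vertex" where
  "adapted_choice x y v =
     (let c = if x \<in> snd v then x else if y \<in> snd v then y else SOME z. z \<in> snd v
      in (Suc (fst v), X \<inter> cball c (delta X (Suc (fst v)))))"

lemma adapted_choice_function: "adapted_choice x y \<in> choice_functions X"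
proof -
  have "adapted_choice x y v \<in> children X v" if v: "v \<in> vertices X" for v
  proof -
    have "(if x \<in> snd v then x else if y \<in> snd v then y else SOME z. z \<in> snd v) \<in> snd v"
      using vertex_nonempty[OF v] by (simp add: some_in_eq)
    then show ?thesis
      unfolding adapted_choice_def Let_def by (rule ball_child[OF v])
  qed
  then show ?thesis
    by (simp add: choice_functions_def)
qed

text \<open>Each ball around \<open>x\<close> contains \<open>x\<close>, so the first branch is
  taken at every step.\<close>

lemma adapted_choice_point_left:
  assumes "x \<in> X"
  shows "choice_point (adapted_choice x y) (n, X \<inter> cball x (delta X n)) = x"
proof (rule choice_point_eqI[OF adapted_choice_function vertex_ball[OF assms]])
  have "(adapted_choice x y ^^ k) (n, X \<inter> cball x (delta X n))
      = (n + k, X \<inter> cball x (delta X (n + k)))" for k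
    using assms by (induction k) (auto simp: adapted_choice_def less_imp_le[OF delta_pos])
  then show "x \<in> snd ((adapted_choice x y ^^ k) (n, X \<inter> cball x (delta X n)))" for k
    using assms by (simp add: less_imp_le[OF delta_pos])
qed

text \<open>The radius must be below \<open>dist x y\<close>: then no ball on the path contains
  \<open>x\<close>, whose priority would otherwise divert the path from \<open>y\<close>.\<close>

lemma adapted_choice_point_right:
  assumes "y \<in> X" "delta X n < dist x y"
  shows "choice_point (adapted_choice x y) (n, X \<inter> cball y (delta X n)) = y"
proof (rule choice_point_eqI[OF adapted_choice_function vertex_ball[OF assms(1)]])
  have "\<not> dist y x \<le> delta X (n + k)" for k
    using assms(2) delta_le[of n "n + k"] by (simp add: dist_commute)
  then have "(adapted_choice x y ^^ k) (n, X \<inter> cball y (delta X n))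
      = (n + k, X \<inter> cball y (delta X (n + k)))" for k
    using assms(1) by (induction k) (auto simp: adapted_choice_def less_imp_le[OF delta_pos])
  then show "y \<in> snd ((adapted_choice x y ^^ k) (n, X \<inter> cball y (delta X n)))" for k
    using assms(1) by (simp add: less_imp_le[OF delta_pos])
qed

lemma spectral_dist_adapted_choice_le:
  assumes x: "x \<in> X" and y: "y \<in> X"
  shows "spectral_dist X (adapted_choice x y) x y \<le> ennreal (dist x y)"
proof (cases "x = y")
  case True
  \<comment> \<open>Treated apart since 0 is not a value of \<open>delta\<close>; every term of the
    supremum vanishes.\<close>
  then show ?thesis
    unfolding spectral_dist_def by (intro SUP_least) simp
next
  case False
  then have "dist x y \<in> range (delta X)"
    using x y by (auto simp: range_delta distances_def)
  then obtain n where n: "dist x y = delta X n"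
    by blast
  \<comment> \<open>Level \<open>n\<close> is the last on which one ball contains both points; one
    level deeper the radius is below \<open>dist x y\<close> and separates them.\<close>
  let ?u = "(n, X \<inter> cball x (delta X n))"
  let ?v = "(Suc n, X \<inter> cball x (delta X (Suc n)))"
  let ?w = "(Suc n, X \<inter> cball y (delta X (Suc n)))"
  have less: "delta X (Suc n) < dist x y"
    using n delta_less by simp
  have "?v \<in> children X ?u" "?w \<in> children X ?u"
    using ball_child[OF vertex_ball[OF x], of x n] ball_child[OF vertex_ball[OF x], of y n]
      x y n delta_pos[of n] by auto
  moreover have "y \<in> snd ?w" "y \<notin> snd ?v"
    using y less by (auto simp: less_imp_le[OF delta_pos])
  then have "?v \<noteq> ?w" by metis
  ultimately have E: "(?v, ?w) \<in> horizontal_edges X"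
    using vertex_ball[OF x] unfolding horizontal_edges_def by blast
  have "cmod (f x - f y) \<le> dist x y"
    if "operator_norm (horizontal_edges X) (dirac_domain X)
      (commutator (dirac X) (choice_rep (adapted_choice x y) f)) \<le> 1" for f
    using bspec[OF that[unfolded commutator_norm_le_1_iff] E]
    by (simp add: adapted_choice_point_left[OF x] adapted_choice_point_right[OF y less]
        edge_length_def n)
  then show ?thesis
    unfolding spectral_dist_def by (intro SUP_least) (auto intro: ennreal_leI)
qed

end

theorem corollary4p5:
  fixes X :: "'a::metric_space set" and \<xi> \<eta> :: 'a
  assumes "infinite X" and "compact X" and "ultrametric_on X"
    and "\<xi> \<in> X" and "\<eta> \<in> X"
  shows "(INF \<tau>\<in>choice_functions X. spectral_dist X \<tau> \<xi> \<eta>) = ennreal (dist \<xi> \<eta>)"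
proof -
  interpret infinite_compact_ultrametric X
    using assms by unfold_locales
  show ?thesis
  proof (rule antisym)
    \<comment> \<open>The infimum is attained, at the choice function adapted to the two
      points.\<close>
    show "(INF \<tau>\<in>choice_functions X. spectral_dist X \<tau> \<xi> \<eta>) \<le> ennreal (dist \<xi> \<eta>)"
      by (rule INF_lower2[where i = "adapted_choice \<xi> \<eta>"])
        (simp_all add: adapted_choice_function spectral_dist_adapted_choice_le assms)
    show "ennreal (dist \<xi> \<eta>) \<le> (INF \<tau>\<in>choice_functions X. spectral_dist X \<tau> \<xi> \<eta>)"
      by (intro INF_greatest dist_le_spectral_dist)
  qed
qed

end
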